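(* The assignments $\mathbf{B}\mapsto\mathbf{R}(\mathbf{B})$ (from basic algebras to Łukasiewicz near semirings) and $\mathbf{R}\mapsto\mathbf{B}(\mathbf{R})$ (from Łukasiewicz near semirings to basic algebras) are mutually inverse: for every basic algebra $\mathbf{B}$ one has $\mathbf{B}(\mathbf{R}(\mathbf{B}))=\mathbf{B}$, and for every Łukasiewicz near semiring $\mathbf{R}$ one has $\mathbf{R}(\mathbf{B}(\mathbf{R}))=\mathbf{R}$ (equality of all operations on the same universe).
   Context: A near semiring is an algebra $\langle R,+,\cdot,0,1\rangle$ such that: (i) $\langle R,+,0\rangle$ is a commutative monoid; (ii) $x\cdot 1=x=1\cdot x$ (multiplication need not be associative or commutative); (iii) $(x+y)\cdot z=(x\cdot z)+(y\cdot z)$; (iv) $x\cdot 0=0\cdot x=0$. It is idempotent if $x+x=x$; then $x\le y$ iff $x+y=y$ defines a partial order, called the induced order. An involutive near semiring is an idempotent near semiring with a map $\alpha:R\to R$ such that $\alpha(\alpha(x))=x$, and $x\le y$ implies $\alpha(y)\le\alpha(x)$. A Łukasiewicz near semiring is an involutive near semiring satisfying the identity $\alpha(x\cdot\alpha(y))\cdot\alpha(y)=\alpha(y\cdot\alpha(x))\cdot\alpha(x)$. A basic algebra is an algebra $\langle A,\oplus,{}',0\rangle$ of type $\langle 2,1,0\rangle$ satisfying, with $1:=0'$: (BA1) $x\oplus 0=x$; (BA2) $x''=x$; (BA3) $(x'\oplus y)'\oplus y=(y'\oplus x)'\oplus x$; (BA4) $(((x\oplus y)'\oplus y)'\oplus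 z)'\oplus(x\oplus z)=1$. For a Łukasiewicz near semiring $\mathbf{R}=\langle R,+,\cdot,0,1,\alpha\rangle$, $\mathbf{B}(\mathbf{R})=\langle R,\oplus,\alpha,0\rangle$ with $x\oplus y=\alpha((\alpha(x)+y)\cdot\alpha(y))$; it is a basic algebra with $x'=\alpha(x)$. For a basic algebra $\mathbf{B}=\langle B,\oplus,{}',0\rangle$, $\mathbf{R}(\mathbf{B})=\langle B,+,\cdot,\alpha,0,1\rangle$ with $x+y=(x'\oplus y)'\oplus y$, $x\cdot y=(x'\oplus y')'$, $\alpha(x)=x'$, $1=0'$; it is a Łukasiewicz near semiring. *)

theory Defs
  imports "HOL-Algebra.Ring" "HOL-Library.FuncSet"
begin

text \<open>
  Operations are required to lie in the extensional function spaces \<open>\<rightarrow>\<^sub>E\<close> over the carrier.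
  They are thus exactly the set-theoretic operations on the universe, and equality of records
  is equality of algebras: same universe and same operations.
\<close>

locale near_semiring =
  fixes R :: "('a, 'm) ring_scheme" (structure)
  assumes add_fun: "add R \<in> carrier R \<rightarrow>\<^sub>E carrier R \<rightarrow>\<^sub>E carrier R"
    and mult_fun: "mult R \<in> carrier R \<rightarrow>\<^sub>E carrier R \<rightarrow>\<^sub>E carrier R"
    and one_in: "\<one> \<in> carrier R"
    and add_comm_monoid: "comm_monoid (add_monoid R)"
    and mult_one_right: "x \<in> carrier R \<Longrightarrow> x \<otimes> \<one> = x"
    and mult_one_left: "x \<in> carrier R \<Longrightarrow> \<one> \<otimes> x = x"
    and distrib_right: "\<lbrakk>x \<in> carrier R; y \<in> carrier R; z \<in> carrier R\<rbrakk>
          \<Longrightarrow> (x \<oplus> y) \<otimes> z = (x \<otimes> z) \<oplus> (y \<otimes> z)"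
    and mult_zero_right: "x \<in> carrier R \<Longrightarrow> x \<otimes> \<zero> = \<zero>"
    and mult_zero_left: "x \<in> carrier R \<Longrightarrow> \<zero> \<otimes> x = \<zero>"

locale idempotent_near_semiring = near_semiring R
  for R :: "('a, 'm) ring_scheme" (structure) +
  assumes add_idem: "x \<in> carrier R \<Longrightarrow> x \<oplus> x = x"

definition induced_le :: "('a, 'm) ring_scheme \<Rightarrow> 'a \<Rightarrow> 'a \<Rightarrow> bool" where
  "induced_le R x y \<longleftrightarrow> x \<oplus>\<^bsub>R\<^esub> y = y"

record 'a invol_ring = "'a ring" +
  invol :: "'a \<Rightarrow> 'a" ("\<alpha>\<index>")

locale involutive_near_semiring = idempotent_near_semiring R
  for R :: "('a, 'm) invol_ring_scheme" (structure) +
  assumes invol_fun: "invol R \<in> carrier R \<rightarrow>\<^sub>E carrier R"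
    and invol_invol: "x \<in> carrier R \<Longrightarrow> \<alpha> (\<alpha> x) = x"
    and invol_antitone: "\<lbrakk>x \<in> carrier R; y \<in> carrier R; induced_le R x y\<rbrakk>
          \<Longrightarrow> induced_le R (\<alpha> y) (\<alpha> x)"

locale lukasiewicz_near_semiring = involutive_near_semiring R
  for R :: "('a, 'm) invol_ring_scheme" (structure) +
  assumes lukasiewicz: "\<lbrakk>x \<in> carrier R; y \<in> carrier R\<rbrakk>
          \<Longrightarrow> \<alpha> (x \<otimes> \<alpha> y) \<otimes> \<alpha> y = \<alpha> (y \<otimes> \<alpha> x) \<otimes> \<alpha> x"

record 'a basic_alg = "'a partial_object" +
  bplus :: "'a \<Rightarrow> 'a \<Rightarrow> 'a" (infixl "\<boxplus>\<index>" 65)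
  bneg :: "'a \<Rightarrow> 'a" ("\<nu>\<index>")
  bzero :: "'a" ("\<o>\<index>")

locale basic_algebra =
  fixes B :: "('a, 'm) basic_alg_scheme" (structure)
  assumes bplus_fun: "bplus B \<in> carrier B \<rightarrow>\<^sub>E carrier B \<rightarrow>\<^sub>E carrier B"
    and bneg_fun: "bneg B \<in> carrier B \<rightarrow>\<^sub>E carrier B"
    and bzero_in: "\<o> \<in> carrier B"
    and BA1: "x \<in> carrier B \<Longrightarrow> x \<boxplus> \<o> = x"
    and BA2: "x \<in> carrier B \<Longrightarrow> \<nu> (\<nu> x) = x"
    and BA3: "\<lbrakk>x \<in> carrier B; y \<in> carrier B\<rbrakk>
          \<Longrightarrow> \<nu> (\<nu> x \<boxplus> y) \<boxplus> y = \<nu> (\<nu> y \<boxplus> x) \<boxplus> x"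
    and BA4: "\<lbrakk>x \<in> carrier B; y \<in> carrier B; z \<in> carrier B\<rbrakk>
          \<Longrightarrow> \<nu> (\<nu> (\<nu> (x \<boxplus> y) \<boxplus> y) \<boxplus> z) \<boxplus> (x \<boxplus> z) = \<nu> \<o>"

definition basic_of :: "'a invol_ring \<Rightarrow> 'a basic_alg" where
  "basic_of R = \<lparr>
     carrier = carrier R,
     bplus = (\<lambda>x\<in>carrier R. \<lambda>y\<in>carrier R. \<alpha>\<^bsub>R\<^esub> ((\<alpha>\<^bsub>R\<^esub> x \<oplus>\<^bsub>R\<^esub> y) \<otimes>\<^bsub>R\<^esub> \<alpha>\<^bsub>R\<^esub> y)),
     bneg = invol R,
     bzero = \<zero>\<^bsub>R\<^esub>\<rparr>"

definition near_semiring_of :: "'a basic_alg \<Rightarrow> 'a invol_ring" where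
  "near_semiring_of B = \<lparr>
     carrier = carrier B,
     mult = (\<lambda>x\<in>carrier B. \<lambda>y\<in>carrier B. \<nu>\<^bsub>B\<^esub> (\<nu>\<^bsub>B\<^esub> x \<boxplus>\<^bsub>B\<^esub> \<nu>\<^bsub>B\<^esub> y)),
     one = \<nu>\<^bsub>B\<^esub> \<o>\<^bsub>B\<^esub>,
     zero = \<o>\<^bsub>B\<^esub>,
     add = (\<lambda>x\<in>carrier B. \<lambda>y\<in>carrier B. \<nu>\<^bsub>B\<^esub> (\<nu>\<^bsub>B\<^esub> x \<boxplus>\<^bsub>B\<^esub> y) \<boxplus>\<^bsub>B\<^esub> y),
     invol = bneg B\<rparr>"

end

theory Submission
  imports Defs
begin

text \<open>
  Both round trips reduce to one fact on each side. In a Lukasiewicz near semiring the constant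
  \<open>\<one>\<close> is the greatest element, \<open>x \<le> y\<close> amounts to \<open>x \<otimes> \<alpha> y = \<zero>\<close>, and the term
  \<open>\<alpha> (\<alpha> (x \<otimes> \<alpha> y) \<otimes> \<alpha> y)\<close>, symmetric by the Lukasiewicz identity, is the least upper bound
  \<open>x \<oplus> y\<close>; so addition is determined by multiplication and involution, and the operation of
  the basic algebra simplifies to \<open>\<alpha> (\<alpha> x \<otimes> \<alpha> y)\<close>. In a basic algebra the same term is the join
  of the order \<open>\<nu> x \<boxplus> y = \<nu> \<o>\<close>, and right distributivity of the product holds because
  \<open>s \<mapsto> \<nu> s \<boxplus> w\<close> is an antitone involution on the elements above \<open>w\<close>.
\<close>

text \<open>Both operations are \<open>undefined\<close> once an argument leaves \<open>A\<close>,
  so agreement on \<open>A\<close> suffices; extensionality is applied once per argument.\<close>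

lemma binop_eqI:
  assumes "f \<in> A \<rightarrow>\<^sub>E A \<rightarrow>\<^sub>E A" "g \<in> A \<rightarrow>\<^sub>E A \<rightarrow>\<^sub>E A"
    and "\<And>x y. \<lbrakk>x \<in> A; y \<in> A\<rbrakk> \<Longrightarrow> f x y = g x y"
  shows "f = g"
proof (rule PiE_ext[OF assms(1,2)])
  fix x assume x: "x \<in> A"
  show "f x = g x"
    using assms(3)[OF x] by (intro PiE_ext[OF PiE_mem[OF assms(1) x] PiE_mem[OF assms(2) x]])
qed

lemma carrier_basic_of [simp]: "carrier (basic_of S) = carrier S"
  by (simp add: basic_of_def)

lemma carrier_near_semiring_of [simp]: "carrier (near_semiring_of B) = carrier B"
  by (simp add: near_semiring_of_def)

section \<open>Order and multiplication in a Lukasiewicz near semiring\<close>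

context lukasiewicz_near_semiring
begin

lemma add_closed [simp, intro]: "\<lbrakk>x \<in> carrier R; y \<in> carrier R\<rbrakk> \<Longrightarrow> x \<oplus> y \<in> carrier R"
  by (rule PiE_mem[OF PiE_mem[OF add_fun]])

lemma mult_closed [simp, intro]: "\<lbrakk>x \<in> carrier R; y \<in> carrier R\<rbrakk> \<Longrightarrow> x \<otimes> y \<in> carrier R"
  by (rule PiE_mem[OF PiE_mem[OF mult_fun]])

lemma invol_closed [simp, intro]: "x \<in> carrier R \<Longrightarrow> \<alpha> x \<in> carrier R"
  by (rule PiE_mem[OF invol_fun])

lemma zero_closed [simp, intro]: "\<zero> \<in> carrier R"
  using monoid.one_closed[OF comm_monoid.axioms(1)[OF add_comm_monoid]] by simp

lemma add_assoc: "\<lbrakk>x \<in> carrier R; y \<in> carrier R; z \<in> carrier R\<rbrakk> \<Longrightarrow> x \<oplus> y \<oplus> z = x \<oplus> (y \<oplus> z)"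
  using monoid.m_assoc[OF comm_monoid.axioms(1)[OF add_comm_monoid]] by simp

lemma add_comm: "\<lbrakk>x \<in> carrier R; y \<in> carrier R\<rbrakk> \<Longrightarrow> x \<oplus> y = y \<oplus> x"
  using comm_monoid.m_comm[OF add_comm_monoid] by simp

lemma add_zero_left: "x \<in> carrier R \<Longrightarrow> \<zero> \<oplus> x = x"
  using monoid.l_one[OF comm_monoid.axioms(1)[OF add_comm_monoid]] by simp

lemma le_antisym:
  "\<lbrakk>induced_le R x y; induced_le R y x; x \<in> carrier R; y \<in> carrier R\<rbrakk> \<Longrightarrow> x = y"
  unfolding induced_le_def by (metis add_comm)

lemma le_add_left: "\<lbrakk>x \<in> carrier R; y \<in> carrier R\<rbrakk> \<Longrightarrow> induced_le R x (x \<oplus> y)"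
  unfolding induced_le_def by (metis add_assoc add_idem)

lemma invol_le_iff:
  "\<lbrakk>x \<in> carrier R; y \<in> carrier R\<rbrakk> \<Longrightarrow> induced_le R (\<alpha> x) (\<alpha> y) \<longleftrightarrow> induced_le R y x"
  using invol_antitone[of y x] invol_antitone[of "\<alpha> x" "\<alpha> y"] by (auto simp: invol_invol)

lemma mult_mono_left:
  "\<lbrakk>induced_le R x y; x \<in> carrier R; y \<in> carrier R; z \<in> carrier R\<rbrakk>
    \<Longrightarrow> induced_le R (x \<otimes> z) (y \<otimes> z)"
  unfolding induced_le_def by (metis distrib_right)

lemma zero_le: "x \<in> carrier R \<Longrightarrow> induced_le R \<zero> x"
  unfolding induced_le_def by (rule add_zero_left)

text \<open>Applying the involution to \<open>\<zero> \<le> \<alpha> \<one>\<close> gives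
  \<open>\<one> \<le> \<alpha> \<zero>\<close>; multiplying by \<open>\<alpha> \<one>\<close> on the
  right gives \<open>\<alpha> \<one> \<le> \<alpha> \<zero> \<otimes> \<alpha> \<one>\<close>, and
  the Lukasiewicz identity at \<open>\<zero>\<close>, \<open>\<one>\<close> makes that product
  \<open>\<zero>\<close>.\<close>

lemma invol_one: "\<alpha> \<one> = \<zero>"
proof -
  have "induced_le R \<one> (\<alpha> \<zero>)"
    by (metis invol_closed invol_invol invol_le_iff one_in zero_closed zero_le)
  then have "induced_le R (\<one> \<otimes> \<alpha> \<one>) (\<alpha> \<zero> \<otimes> \<alpha> \<one>)"
    by (intro mult_mono_left one_in invol_closed zero_closed)
  moreover have "\<alpha> \<zero> \<otimes> \<alpha> \<one> = \<zero>"
    using lukasiewicz[of \<zero> \<one>] one_in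
    by (metis invol_closed invol_invol lukasiewicz mult_one_left mult_zero_left zero_closed)
  ultimately show ?thesis
    by (metis invol_closed le_antisym mult_one_left one_in zero_closed zero_le)
qed

lemma invol_zero: "\<alpha> \<zero> = \<one>"
  using invol_one invol_invol one_in by metis

lemma le_one: "x \<in> carrier R \<Longrightarrow> induced_le R x \<one>"
  by (metis invol_closed invol_le_iff invol_zero invol_invol zero_closed zero_le)

lemma mult_le_right: "\<lbrakk>x \<in> carrier R; y \<in> carrier R\<rbrakk> \<Longrightarrow> induced_le R (x \<otimes> y) y"
  by (metis le_one mult_mono_left mult_one_left one_in)

text \<open>At \<open>x\<close>, \<open>\<one>\<close> one side of the Lukasiewicz identity ends in
  the factor \<open>\<alpha> \<one> = \<zero>\<close>, while the other reduces to
  \<open>x \<otimes> \<alpha> x\<close>.\<close>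

lemma mult_invol_self: "x \<in> carrier R \<Longrightarrow> x \<otimes> \<alpha> x = \<zero>"
  using lukasiewicz[of x \<one>] one_in
  by (simp add: invol_one mult_zero_right mult_one_left invol_invol)

text \<open>Forwards, \<open>x \<otimes> \<alpha> y \<le> y \<otimes> \<alpha> y = \<zero>\<close>.
  Backwards, the Lukasiewicz identity turns \<open>\<alpha> y\<close> into a product with right
  factor \<open>\<alpha> x\<close>, hence \<open>\<alpha> y \<le> \<alpha> x\<close>.\<close>

lemma le_iff_mult_invol:
  assumes x: "x \<in> carrier R" and y: "y \<in> carrier R"
  shows "induced_le R x y \<longleftrightarrow> x \<otimes> \<alpha> y = \<zero>"
proof
  assume "induced_le R x y"
  then show "x \<otimes> \<alpha> y = \<zero>"
    by (metis invol_closed le_antisym mult_closed mult_invol_self mult_mono_left x y zero_closed zero_le)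
next
  assume "x \<otimes> \<alpha> y = \<zero>"
  then have "\<alpha> y = \<alpha> (y \<otimes> \<alpha> x) \<otimes> \<alpha> x"
    using lukasiewicz[OF x y] y by (simp add: invol_zero mult_one_left)
  then show "induced_le R x y"
    by (metis invol_closed invol_le_iff mult_closed mult_le_right x y)
qed

lemma add_eq_mult:
  assumes x: "x \<in> carrier R" and y: "y \<in> carrier R"
  shows "x \<oplus> y = \<alpha> (\<alpha> (x \<otimes> \<alpha> y) \<otimes> \<alpha> y)"
proof -
  let ?J = "\<lambda>x y. \<alpha> (\<alpha> (x \<otimes> \<alpha> y) \<otimes> \<alpha> y)"
  \<comment> \<open>A product lies below its right factor, here \<open>\<alpha> b\<close>; the
    involution reverses this.\<close>
  have upper: "induced_le R b (?J a b)" if "a \<in> carrier R" "b \<in> carrier R" for a b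
    using mult_le_right[of "\<alpha> (a \<otimes> \<alpha> b)" "\<alpha> b"] that
    by (metis invol_antitone invol_closed invol_invol mult_closed)
  have comm: "?J x y = ?J y x"
    using lukasiewicz[OF x y] by simp
  have J: "?J x y \<in> carrier R"
    using x y by simp
  have "x \<oplus> ?J x y = ?J x y" "y \<oplus> ?J x y = ?J x y"
    using upper[OF x y] upper[OF y x] comm by (simp_all add: induced_le_def)
  then have 1: "induced_le R (x \<oplus> y) (?J x y)"
    using x y J by (simp add: induced_le_def add_assoc)
  let ?s = "x \<oplus> y"
  have s: "?s \<in> carrier R"
    using x y by simp
  \<comment> \<open>\<open>?J\<close> is monotone in its first argument, so
    \<open>?J x y \<le> ?J ?s y\<close>; by symmetry the latter is \<open>?J y ?s\<close>, which
    collapses to \<open>?s\<close> because \<open>y \<le> ?s\<close>.\<close>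
  have "induced_le R (x \<otimes> \<alpha> y) (?s \<otimes> \<alpha> y)"
    using x y by (intro mult_mono_left le_add_left) auto
  then have "induced_le R (\<alpha> (?s \<otimes> \<alpha> y) \<otimes> \<alpha> y) (\<alpha> (x \<otimes> \<alpha> y) \<otimes> \<alpha> y)"
    using x y s by (intro mult_mono_left) (auto simp: invol_le_iff)
  then have "induced_le R (?J x y) (?J ?s y)"
    using x y s by (simp add: invol_le_iff)
  also have "?J ?s y = \<alpha> (\<alpha> (y \<otimes> \<alpha> ?s) \<otimes> \<alpha> ?s)"
    using lukasiewicz[OF s y] by simp
  also have "y \<otimes> \<alpha> ?s = \<zero>"
    using le_iff_mult_invol[OF y s] le_add_left[OF y x] add_comm[OF x y] by simp
  also have "\<alpha> (\<alpha> \<zero> \<otimes> \<alpha> ?s) = ?s"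
    using s by (simp add: invol_zero mult_one_left invol_invol)
  finally show ?thesis
    using 1 J s le_antisym by blast
qed

end

section \<open>From Lukasiewicz near semirings to basic algebras\<close>

context
  fixes R :: "'a invol_ring" (structure)
  assumes luk: "lukasiewicz_near_semiring R"
begin

interpretation lukasiewicz_near_semiring R
  by (rule luk)

text \<open>Right distributivity splits off the summand \<open>y \<otimes> \<alpha> y\<close>, which
  is \<open>\<zero>\<close>.\<close>

lemma bplus_basic_of:
  assumes "x \<in> carrier R" "y \<in> carrier R"
  shows "bplus (basic_of R) x y = \<alpha> (\<alpha> x \<otimes> \<alpha> y)"
proof -
  have "(\<alpha> x \<oplus> y) \<otimes> \<alpha> y = \<zero> \<oplus> \<alpha> x \<otimes> \<alpha> y"
    using assms by (simp add: distrib_right mult_invol_self add_comm)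
  then show ?thesis
    using assms by (simp add: basic_of_def add_zero_left)
qed

lemma bneg_basic_of: "bneg (basic_of R) = invol R"
  by (simp add: basic_of_def)

lemma bzero_basic_of: "bzero (basic_of R) = \<zero>"
  by (simp add: basic_of_def)

lemma basic_algebra_basic_of: "basic_algebra (basic_of R)"
proof
  note simps = bplus_basic_of bneg_basic_of bzero_basic_of invol_invol invol_zero
  show "bplus (basic_of R) \<in> carrier (basic_of R) \<rightarrow>\<^sub>E carrier (basic_of R) \<rightarrow>\<^sub>E carrier (basic_of R)"
    by (auto simp: basic_of_def)
  show "bneg (basic_of R) \<in> carrier (basic_of R) \<rightarrow>\<^sub>E carrier (basic_of R)"
    using invol_fun by (simp add: bneg_basic_of)
  show "bzero (basic_of R) \<in> carrier (basic_of R)"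
    by (simp add: bzero_basic_of)
  fix x y z
  assume "x \<in> carrier (basic_of R)"
  then have x: "x \<in> carrier R" by simp
  then show "bplus (basic_of R) x (bzero (basic_of R)) = x"
    and "bneg (basic_of R) (bneg (basic_of R) x) = x"
    by (simp_all add: simps mult_one_right)
  assume "y \<in> carrier (basic_of R)"
  then have y: "y \<in> carrier R" by simp
  show "bplus (basic_of R) (bneg (basic_of R) (bplus (basic_of R) (bneg (basic_of R) x) y)) y =
    bplus (basic_of R) (bneg (basic_of R) (bplus (basic_of R) (bneg (basic_of R) y) x)) x"
    using x y lukasiewicz[OF x y] by (simp add: simps)
  assume "z \<in> carrier (basic_of R)"
  then have z: "z \<in> carrier R" by simp
  \<comment> \<open>In BA4 the inner term \<open>\<nu> (x \<boxplus> y) \<boxplus> y\<close> is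
    \<open>?s\<close> by \<open>add_eq_mult\<close>, and the whole identity then says
    \<open>\<alpha> x \<otimes> \<alpha> z \<le> ?s \<otimes> \<alpha> z\<close>, an instance of
    left monotonicity.\<close>
  let ?s = "\<alpha> x \<oplus> y"
  have s: "?s \<in> carrier R"
    using x y by simp
  have "induced_le R (\<alpha> x \<otimes> \<alpha> z) (?s \<otimes> \<alpha> z)"
    using x y z by (intro mult_mono_left le_add_left) auto
  then have "induced_le R (\<alpha> (?s \<otimes> \<alpha> z)) (\<alpha> (\<alpha> x \<otimes> \<alpha> z))"
    using x s z by (simp add: invol_le_iff)
  then have "\<alpha> (?s \<otimes> \<alpha> z) \<otimes> (\<alpha> x \<otimes> \<alpha> z) = \<zero>"
    using x s z by (simp add: le_iff_mult_invol invol_invol)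
  moreover have "\<alpha> (\<alpha> (\<alpha> x \<otimes> \<alpha> y) \<otimes> \<alpha> y) = ?s"
    using add_eq_mult[of "\<alpha> x" y] x y by simp
  ultimately show "bplus (basic_of R) (bneg (basic_of R) (bplus (basic_of R)
      (bneg (basic_of R) (bplus (basic_of R) (bneg (basic_of R) (bplus (basic_of R) x y)) y)) z))
      (bplus (basic_of R) x z) = bneg (basic_of R) (bzero (basic_of R))"
    using x y z s by (simp add: simps)
qed

lemma near_semiring_of_basic_of: "near_semiring_of (basic_of R) = R"
proof -
  note simps = bplus_basic_of bneg_basic_of bzero_basic_of invol_invol invol_zero
  have "mult (near_semiring_of (basic_of R)) = mult R"
    by (rule binop_eqI[of _ "carrier R"])
      (use mult_fun in \<open>auto simp: near_semiring_of_def simps\<close>)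
  moreover have "add (near_semiring_of (basic_of R)) = add R"
    by (rule binop_eqI[of _ "carrier R"])
      (use add_fun in \<open>auto simp: near_semiring_of_def simps add_eq_mult\<close>)
  ultimately show ?thesis
    by (intro invol_ring.equality ring.equality) (auto simp: near_semiring_of_def simps)
qed

end

section \<open>Order, joins and monotonicity in a basic algebra\<close>

context basic_algebra
begin

definition join :: "'a \<Rightarrow> 'a \<Rightarrow> 'a" where
  "join x y = \<nu> (\<nu> x \<boxplus> y) \<boxplus> y"

text \<open>In this form BA4 is itself an inequality; \<open>le_iff_join\<close> later identifies
  the order with the one induced by \<open>join\<close>.\<close>

definition le :: "'a \<Rightarrow> 'a \<Rightarrow> bool" where
  "le x y \<longleftrightarrow> \<nu> x \<boxplus> y = \<nu> \<o>"

lemma bplus_closed [simp, intro]: "\<lbrakk>x \<in> carrier B; y \<in> carrier B\<rbrakk> \<Longrightarrow> x \<boxplus> y \<in> carrier B"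
  by (rule PiE_mem[OF PiE_mem[OF bplus_fun]])

lemma bneg_closed [simp, intro]: "x \<in> carrier B \<Longrightarrow> \<nu> x \<in> carrier B"
  by (rule PiE_mem[OF bneg_fun])

lemma bzero_closed [simp, intro]: "\<o> \<in> carrier B"
  by (rule bzero_in)

lemma join_closed [simp, intro]: "\<lbrakk>x \<in> carrier B; y \<in> carrier B\<rbrakk> \<Longrightarrow> join x y \<in> carrier B"
  by (simp add: join_def)

lemma join_comm: "\<lbrakk>x \<in> carrier B; y \<in> carrier B\<rbrakk> \<Longrightarrow> join x y = join y x"
  unfolding join_def by (rule BA3)

lemma le_refl: "x \<in> carrier B \<Longrightarrow> le x x"
  unfolding le_def using BA4[of x \<o> \<o>] by (simp add: BA1 BA2)

text \<open>BA3 gives \<open>join \<o> x = x\<close>, and BA4 at \<open>z = \<o>\<close> gives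
  \<open>join a b \<boxplus> \<nu> a = \<nu> \<o>\<close>. Taking \<open>a = \<o>\<close> yields
  \<open>x \<boxplus> \<nu> \<o> = \<nu> \<o>\<close>, so
  \<open>join x (\<nu> \<o>) = \<nu> \<o>\<close>; taking \<open>a = x\<close>,
  \<open>b = \<nu> \<o>\<close> yields \<open>\<nu> \<o> \<boxplus> \<nu> x = \<nu> \<o>\<close>.
  Every element is a negation, so \<open>join \<o> x\<close> is also
  \<open>\<o> \<boxplus> x\<close>.\<close>

lemma bzero_bplus: "x \<in> carrier B \<Longrightarrow> \<o> \<boxplus> x = x"
  by (metis (full_types) BA1 BA2 BA3 BA4 bneg_closed bplus_closed bzero_closed)

lemma join_bplus_bneg: "\<lbrakk>x \<in> carrier B; y \<in> carrier B\<rbrakk> \<Longrightarrow> join x y \<boxplus> \<nu> x = \<nu> \<o>"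
  using BA4[of "\<nu> x" y \<o>] by (simp add: BA1 BA2 join_def)

text \<open>BA4 at \<open>\<nu> x\<close> in order form, the source of the upper bound property of
  \<open>join\<close> and of the monotonicity of \<open>\<boxplus>\<close> in its left
  argument.\<close>

lemma join_bplus_le:
  "\<lbrakk>x \<in> carrier B; y \<in> carrier B; z \<in> carrier B\<rbrakk> \<Longrightarrow> le (\<nu> (join x y) \<boxplus> z) (\<nu> x \<boxplus> z)"
  using BA4[of "\<nu> x" y z] by (simp add: le_def join_def)

lemma join_eq_of_le: "\<lbrakk>le x y; x \<in> carrier B; y \<in> carrier B\<rbrakk> \<Longrightarrow> join x y = y"
  by (simp add: le_def join_def BA2 bzero_bplus)

lemma one_leD: "\<lbrakk>le (\<nu> \<o>) x; x \<in> carrier B\<rbrakk> \<Longrightarrow> x = \<nu> \<o>"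
  by (simp add: le_def BA2 bzero_bplus)

text \<open>With \<open>z = join x y\<close> the left side of \<open>join_bplus_le\<close> is the
  top element, hence so is the right side.\<close>

lemma le_join_left:
  assumes "x \<in> carrier B" "y \<in> carrier B"
  shows "le x (join x y)"
proof -
  have "\<nu> (join x y) \<boxplus> join x y = \<nu> \<o>"
    using le_refl[of "join x y"] assms by (simp add: le_def)
  then show ?thesis
    using join_bplus_le[of x y "join x y"] one_leD assms by (simp add: le_def)
qed

lemma le_join_right: "\<lbrakk>x \<in> carrier B; y \<in> carrier B\<rbrakk> \<Longrightarrow> le y (join x y)"
  using le_join_left[of y x] by (simp add: join_comm)

lemma le_iff_join: "\<lbrakk>x \<in> carrier B; y \<in> carrier B\<rbrakk> \<Longrightarrow> le x y \<longleftrightarrow> join x y = y"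
  using join_eq_of_le le_join_left by metis

lemma bzero_le: "x \<in> carrier B \<Longrightarrow> le \<o> x"
  using le_iff_join[of \<o> x] join_comm[of \<o> x] by (simp add: join_def BA1 BA2)

lemma bplus_one: "x \<in> carrier B \<Longrightarrow> x \<boxplus> \<nu> \<o> = \<nu> \<o>"
  using join_bplus_bneg[of \<o> x] join_eq_of_le[OF bzero_le] by simp

lemma one_bplus: "x \<in> carrier B \<Longrightarrow> \<nu> \<o> \<boxplus> x = \<nu> \<o>"
  using bzero_le[of x] by (simp add: le_def)

lemma le_antisym: "\<lbrakk>le x y; le y x; x \<in> carrier B; y \<in> carrier B\<rbrakk> \<Longrightarrow> x = y"
  by (metis join_comm join_eq_of_le)

lemma bneg_antitone:
  "\<lbrakk>le x y; x \<in> carrier B; y \<in> carrier B\<rbrakk> \<Longrightarrow> le (\<nu> y) (\<nu> x)"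
  using join_bplus_bneg[of x y] join_eq_of_le[of x y] by (simp add: le_def BA2)

lemma bneg_le_swap:
  "\<lbrakk>le (\<nu> x) y; x \<in> carrier B; y \<in> carrier B\<rbrakk> \<Longrightarrow> le (\<nu> y) x"
  using bneg_antitone[of "\<nu> x" y] by (simp add: BA2)

text \<open>From \<open>\<nu> y \<le> \<nu> x\<close> it follows that
  \<open>join (\<nu> y) (\<nu> x) = \<nu> x\<close>, and \<open>join_bplus_le\<close> becomes the
  claim.\<close>

lemma bplus_mono:
  assumes "le x y" "x \<in> carrier B" "y \<in> carrier B" "z \<in> carrier B"
  shows "le (x \<boxplus> z) (y \<boxplus> z)"
  using join_bplus_le[of "\<nu> y" "\<nu> x" z] join_eq_of_le[OF bneg_antitone[OF assms(1-3)]] assms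
  by (simp add: BA2)

text \<open>From \<open>x \<le> y\<close> comes
  \<open>\<nu> y \<boxplus> z \<le> \<nu> x \<boxplus> z\<close>, and \<open>y \<le> z\<close> makes
  the smaller side the top element.\<close>

lemma le_trans:
  "\<lbrakk>le x y; le y z; x \<in> carrier B; y \<in> carrier B; z \<in> carrier B\<rbrakk> \<Longrightarrow> le x z"
  using bplus_mono[OF bneg_antitone, of x y z] one_leD[of "\<nu> x \<boxplus> z"] by (simp add: le_def)

lemma le_bplus_right: "\<lbrakk>x \<in> carrier B; y \<in> carrier B\<rbrakk> \<Longrightarrow> le y (x \<boxplus> y)"
  using bplus_mono[OF bzero_le[of x], of y] by (simp add: bzero_bplus)

lemma join_least:
  assumes "le x z" "le y z" "x \<in> carrier B" "y \<in> carrier B" "z \<in> carrier B"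
  shows "le (join x y) z"
proof -
  have "le (\<nu> (\<nu> x \<boxplus> y) \<boxplus> y) (\<nu> (\<nu> z \<boxplus> y) \<boxplus> y)"
    using assms by (intro bplus_mono bneg_antitone) auto
  moreover have "join z y = z"
    using assms join_eq_of_le[of y z] join_comm[of y z] by simp
  ultimately show ?thesis
    by (simp add: join_def)
qed

lemma le_joinI1:
  "\<lbrakk>le z x; x \<in> carrier B; y \<in> carrier B; z \<in> carrier B\<rbrakk> \<Longrightarrow> le z (join x y)"
  using le_trans[OF _ le_join_left] by simp

lemma le_joinI2:
  "\<lbrakk>le z y; x \<in> carrier B; y \<in> carrier B; z \<in> carrier B\<rbrakk> \<Longrightarrow> le z (join x y)"
  using le_trans[OF _ le_join_right] by simp

lemma join_assoc:
  assumes x: "x \<in> carrier B" and y: "y \<in> carrier B" and z: "z \<in> carrier B"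
  shows "join (join x y) z = join x (join y z)"
proof (rule le_antisym)
  show "le (join (join x y) z) (join x (join y z))"
    using x y z by (intro join_least) (auto intro: le_joinI1 le_joinI2 le_refl)
  show "le (join x (join y z)) (join (join x y) z)"
    using x y z by (intro join_least) (auto intro: le_joinI1 le_joinI2 le_refl)
qed (use x y z in auto)

text \<open>Right distributivity in disguise: \<open>\<nu> (\<nu> a \<boxplus> w)\<close> is the
  product of \<open>a\<close> and \<open>\<nu> w\<close> in the near semiring.\<close>

lemma bneg_bplus_join:
  assumes x: "x \<in> carrier B" and y: "y \<in> carrier B" and w: "w \<in> carrier B"
  shows "\<nu> (\<nu> (join x y) \<boxplus> w) = join (\<nu> (\<nu> x \<boxplus> w)) (\<nu> (\<nu> y \<boxplus> w))"
proof (rule le_antisym)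
  let ?u = "join (\<nu> (\<nu> x \<boxplus> w)) (\<nu> (\<nu> y \<boxplus> w))"
  \<comment> \<open>\<open>?s\<close> lifts \<open>\<nu> ?u\<close> above \<open>w\<close>, where
    \<open>s \<mapsto> \<nu> s \<boxplus> w\<close> is an involution; its image \<open>?g\<close>
    will bound both \<open>x\<close> and \<open>y\<close>.\<close>
  let ?s = "join (\<nu> ?u) w"
  let ?g = "\<nu> ?s \<boxplus> w"
  have u: "?u \<in> carrier B" and s: "?s \<in> carrier B" and g: "?g \<in> carrier B"
    using x y w by auto
  \<comment> \<open>Half of an adjunction: a bound \<open>?u\<close> on the product with
    \<open>\<nu> w\<close> becomes the bound \<open>?g\<close> on \<open>a\<close>, since
    \<open>a \<le> join a w = \<nu> (\<nu> a \<boxplus> w) \<boxplus> w\<close>.\<close>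
  have below: "le a ?g" if "a \<in> carrier B" "le (\<nu> (\<nu> a \<boxplus> w)) ?u" for a
  proof -
    have "le (\<nu> ?u) (\<nu> a \<boxplus> w)"
      using bneg_le_swap[OF that(2)] that(1) w u by simp
    then have "le ?s (\<nu> a \<boxplus> w)"
      using that(1) w u by (intro join_least le_bplus_right) auto
    then have "le (join a w) ?g"
      using that w s unfolding join_def[of a w] by (intro bplus_mono bneg_antitone) auto
    then show ?thesis
      using le_trans[OF le_join_left] that w g by blast
  qed
  have "le (join x y) ?g"
    using x y w g by (intro join_least below le_join_left le_join_right) auto
  \<comment> \<open>The way back: \<open>\<nu> ?g \<boxplus> w\<close> is by definition
    \<open>join ?s w\<close>, which lies above \<open>\<nu> ?u\<close>.\<close>
  then have "le (join ?s w) (\<nu> (join x y) \<boxplus> w)"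
    unfolding join_def[of ?s w] using x y w g by (intro bplus_mono bneg_antitone) auto
  then have "le (\<nu> ?u) (\<nu> (join x y) \<boxplus> w)"
    using x y w u s le_trans[of "\<nu> ?u" "join ?s w"] by (simp add: le_joinI1 le_join_left)
  then show "le (\<nu> (\<nu> (join x y) \<boxplus> w)) ?u"
    using x y w u bneg_le_swap[of ?u] by simp
  show "le ?u (\<nu> (\<nu> (join x y) \<boxplus> w))"
    using x y w
    by (intro join_least bneg_antitone bplus_mono le_join_left le_join_right) auto
qed (use x y w in auto)

end

section \<open>From basic algebras to Lukasiewicz near semirings, and the round trip\<close>

context
  fixes B :: "'a basic_alg" (structure)
  assumes basic: "basic_algebra B"
begin

interpretation basic_algebra B
  by (rule basic)

lemma add_near_semiring_of:
  "\<lbrakk>x \<in> carrier B; y \<in> carrier B\<rbrakk> \<Longrightarrow> add (near_semiring_of B) x y = join x y"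
  by (simp add: near_semiring_of_def join_def)

lemma mult_near_semiring_of:
  "\<lbrakk>x \<in> carrier B; y \<in> carrier B\<rbrakk>
    \<Longrightarrow> mult (near_semiring_of B) x y = \<nu> (\<nu> x \<boxplus> \<nu> y)"
  by (simp add: near_semiring_of_def)

lemma one_near_semiring_of: "one (near_semiring_of B) = \<nu> \<o>"
  by (simp add: near_semiring_of_def)

lemma zero_near_semiring_of: "zero (near_semiring_of B) = \<o>"
  by (simp add: near_semiring_of_def)

lemma invol_near_semiring_of: "invol (near_semiring_of B) = bneg B"
  by (simp add: near_semiring_of_def)

lemma lukasiewicz_near_semiring_of: "lukasiewicz_near_semiring (near_semiring_of B)"
proof (intro lukasiewicz_near_semiring.intro lukasiewicz_near_semiring_axioms.intro
    involutive_near_semiring.intro involutive_near_semiring_axioms.intro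
    idempotent_near_semiring.intro idempotent_near_semiring_axioms.intro near_semiring.intro)
  note simps = add_near_semiring_of mult_near_semiring_of one_near_semiring_of
    zero_near_semiring_of invol_near_semiring_of BA1 BA2 bzero_bplus
  let ?R = "near_semiring_of B"
  show "add ?R \<in> carrier ?R \<rightarrow>\<^sub>E carrier ?R \<rightarrow>\<^sub>E carrier ?R"
    and "mult ?R \<in> carrier ?R \<rightarrow>\<^sub>E carrier ?R \<rightarrow>\<^sub>E carrier ?R"
    by (auto simp: near_semiring_of_def)
  show "invol ?R \<in> carrier ?R \<rightarrow>\<^sub>E carrier ?R"
    using bneg_fun by (simp add: simps)
  show "one ?R \<in> carrier ?R"
    by (simp add: simps)
  show "comm_monoid (add_monoid ?R)"
    by (rule comm_monoidI)
      (auto simp: simps join_assoc join_eq_of_le bzero_le intro: join_comm)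
  fix x
  assume "x \<in> carrier ?R"
  then have x: "x \<in> carrier B" by simp
  then show "mult ?R x (one ?R) = x" "mult ?R (one ?R) x = x"
    "mult ?R x (zero ?R) = zero ?R" "mult ?R (zero ?R) x = zero ?R"
    "add ?R x x = x" "invol ?R (invol ?R x) = x"
    by (simp_all add: simps bplus_one one_bplus join_eq_of_le le_refl)
  fix y
  assume "y \<in> carrier ?R"
  then have y: "y \<in> carrier B" by simp
  show "mult ?R (invol ?R (mult ?R x (invol ?R y))) (invol ?R y) =
      mult ?R (invol ?R (mult ?R y (invol ?R x))) (invol ?R x)"
    using x y BA3[OF x y] by (simp add: simps)
  show "induced_le ?R (invol ?R y) (invol ?R x)" if "induced_le ?R x y"
    using that x y bneg_antitone[of x y] by (simp add: induced_le_def simps le_iff_join)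
  fix z
  assume "z \<in> carrier ?R"
  then have z: "z \<in> carrier B" by simp
  show "mult ?R (add ?R x y) z = add ?R (mult ?R x z) (mult ?R y z)"
    using x y z by (simp add: simps bneg_bplus_join)
qed

text \<open>Since the near semiring is known to be Lukasiewicz, \<open>bplus_basic_of\<close>
  removes the sum from the defining term, and only double negations are left to cancel.\<close>

lemma basic_of_near_semiring_of: "basic_of (near_semiring_of B) = B"
proof -
  interpret R: lukasiewicz_near_semiring "near_semiring_of B"
    by (rule lukasiewicz_near_semiring_of)
  have "bplus (basic_of (near_semiring_of B)) = bplus B"
  proof (rule binop_eqI[of _ "carrier B"])
    show "bplus (basic_of (near_semiring_of B)) \<in> carrier B \<rightarrow>\<^sub>E carrier B \<rightarrow>\<^sub>E carrier B"
      using basic_algebra.bplus_fun[OF basic_algebra_basic_of[OF lukasiewicz_near_semiring_of]]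
      by simp
    fix x y
    assume "x \<in> carrier B" "y \<in> carrier B"
    then show "bplus (basic_of (near_semiring_of B)) x y = x \<boxplus> y"
      by (simp add: bplus_basic_of[OF lukasiewicz_near_semiring_of]
          mult_near_semiring_of invol_near_semiring_of BA2)
  qed (rule bplus_fun)
  then show ?thesis
    by (intro basic_alg.equality) (simp_all add: basic_of_def near_semiring_of_def)
qed

end

theorem theorem6:
  "(\<forall>B :: 'a basic_alg. basic_algebra B \<longrightarrow>
      lukasiewicz_near_semiring (near_semiring_of B) \<and>
      basic_of (near_semiring_of B) = B) \<and>
   (\<forall>R :: 'a invol_ring. lukasiewicz_near_semiring R \<longrightarrow>
      basic_algebra (basic_of R) \<and>
      near_semiring_of (basic_of R) = R)"
  using lukasiewicz_near_semiring_of basic_of_near_semiring_of basic_algebra_basic_of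
    near_semiring_of_basic_of by blast

end
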